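(* Let $\alpha \in \overline{\mathbb{H}}$ and let $(X_i)_{i\ge 1}$ be i.i.d. real-valued continuous random variables such that $X_1$ is in $L^{0+}$, i.e. $E[|X_1|^{\beta}] < +\infty$ for some $\beta > 0$. Let \[ G_n^{(\alpha)} := \prod_{j=1}^{n} (X_j + \alpha)^{1/n} - \alpha . \] Then \[ \lim_{n \to \infty} n\, \mathrm{Var}\left( G_n^{(\alpha)} \right) = \exp\left(2E[\log |X_1 + \alpha|]\right) \mathrm{Var}\left(\log (X_1 + \alpha)\right). \]
   Context: $\overline{\mathbb{H}} = \{x+yi : x\in\mathbb{R},\, y \ge 0\}$. For $z = r e^{i\theta}$ with $r>0$ and $-\pi/2 \le \theta < 3\pi/2$, $\log z := \log r + i\theta$; for $p \in \mathbb{R}$, $z^p := \exp(p \log z)$. (So for $x<0$, $\log x = \log|x| + i\pi$.) A real-valued random variable $X$ is called continuous if $P(X=x)=0$ for every $x \in \mathbb{R}$. For a complex-valued random variable $Y$, $E[Y] := E[\mathrm{Re}(Y)] + iE[\mathrm{Im}(Y)]$ and $\mathrm{Var}(Y) := E[|Y - E[Y]|^2]$.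
   Formalization: For real α it is additionally assumed that E|log|X_1+α|| is finite; otherwise E[log|X_1+α|] = -∞ and the right-hand side has the undefined form 0·∞ (examples exist with limit 0 and with limit ∞). *)

theory Defs
  imports "HOL-Probability.Probability"
begin

text \<open>The argument in \<open>[-\<pi>/2, 3\<pi>/2)\<close>, so that the cut is the negative imaginary axis and
  the logarithm is continuous on the closed upper half plane without the origin.\<close>

definition arg_cut :: "complex \<Rightarrow> real" where
  "arg_cut z = (THE \<theta>. - pi / 2 \<le> \<theta> \<and> \<theta> < 3 * pi / 2 \<and>
                  z = of_real (cmod z) * exp (\<i> * of_real \<theta>))"

text \<open>The value at \<open>0\<close> is a dummy; for an atomless real \<open>X\<close>, the event
  \<open>X + \<alpha> = 0\<close> has probability zero.\<close>

definition log_cut :: "complex \<Rightarrow> complex" where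
  "log_cut z = (if z = 0 then 0 else of_real (ln (cmod z)) + \<i> * of_real (arg_cut z))"

definition pow_cut :: "complex \<Rightarrow> real \<Rightarrow> complex" where
  "pow_cut z p = exp (of_real p * log_cut z)"

lemma arg_cut_eqI:
  assumes "z \<noteq> 0" "- pi / 2 \<le> \<theta>" "\<theta> < 3 * pi / 2"
    and "z = of_real (cmod z) * exp (\<i> * of_real \<theta>)"
  shows "arg_cut z = \<theta>"
  unfolding arg_cut_def
proof (rule the_equality)
  fix t assume t: "- pi / 2 \<le> t \<and> t < 3 * pi / 2 \<and> z = of_real (cmod z) * exp (\<i> * of_real t)"
  then have "exp (\<i> * of_real t) = exp (\<i> * of_real \<theta>)"
    using assms by (metis mult_left_cancel norm_eq_zero of_real_eq_0_iff)
  then obtain k :: int where "\<i> * of_real t = \<i> * of_real \<theta> + of_int (2 * k) * pi * \<i>"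
    using exp_eq by metis
  then have "t = \<theta> + 2 * of_int k * pi"
    by (simp add: complex_eq_iff)
  moreover from this have "\<bar>2 * of_int k * pi\<bar> < 2 * pi"
    using t assms by linarith
  then have "\<bar>of_int k :: real\<bar> < 1"
    by (simp add: abs_mult)
  then have "k = 0" by linarith
  ultimately show "t = \<theta>" by simp
qed (use assms in auto)

lemma arg_cut_Arg2pi:
  assumes "z \<noteq> 0"
  shows "arg_cut z = Arg2pi (\<i> * z) - pi / 2"
proof (rule arg_cut_eqI)
  have "\<i> * z = of_real (cmod z) * exp (\<i> * of_real (Arg2pi (\<i> * z)))"
    using Arg2pi[of "\<i> * z"] by (simp add: norm_mult is_Arg_def)
  moreover have "exp (\<i> * of_real (Arg2pi (\<i> * z) - pi / 2))
      = exp (\<i> * of_real (Arg2pi (\<i> * z))) * exp (- (\<i> * of_real pi / 2))"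
    by (simp add: exp_add[symmetric] algebra_simps)
  moreover have "exp (- (\<i> * of_real pi / 2)) = - \<i>"
    by (simp add: complex_eq_iff Re_exp Im_exp)
  ultimately have "of_real (cmod z) * exp (\<i> * of_real (Arg2pi (\<i> * z) - pi / 2)) = \<i> * z * - \<i>"
    by (simp add: mult.assoc)
  then show "z = of_real (cmod z) * exp (\<i> * of_real (Arg2pi (\<i> * z) - pi / 2))"
    by (simp add: complex_eq_iff)
qed (use assms Arg2pi_ge_0[of "\<i> * z"] Arg2pi_lt_2pi[of "\<i> * z"] in auto)

definition cexpectation :: "'a measure \<Rightarrow> ('a \<Rightarrow> complex) \<Rightarrow> complex" where
  "cexpectation M Y = of_real (\<integral>\<omega>. Re (Y \<omega>) \<partial>M) + \<i> * of_real (\<integral>\<omega>. Im (Y \<omega>) \<partial>M)"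

lemma cexpectation_eq_integral:
  "integrable M Y \<Longrightarrow> cexpectation M Y = (\<integral>\<omega>. Y \<omega> \<partial>M)"
  by (simp add: cexpectation_def complex_eq_iff)

text \<open>Extended-valued, so that a variable without second moment has variance \<open>\<infinity>\<close>
  rather than the dummy value of a Bochner integral.\<close>

definition cvariance :: "'a measure \<Rightarrow> ('a \<Rightarrow> complex) \<Rightarrow> ennreal" where
  "cvariance M Y = (\<integral>\<^sup>+\<omega>. ennreal ((cmod (Y \<omega> - cexpectation M Y))\<^sup>2) \<partial>M)"

definition geom_mean :: "complex \<Rightarrow> (nat \<Rightarrow> 'a \<Rightarrow> real) \<Rightarrow> nat \<Rightarrow> 'a \<Rightarrow> complex" where
  "geom_mean \<alpha> X n \<omega> = (\<Prod>j=1..n. pow_cut (of_real (X j \<omega>) + \<alpha>) (1 / real n)) - \<alpha>"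

end

theory Submission
  imports Defs
begin

text \<open>Put \<open>L = log (X\<^sub>1 + \<alpha>)\<close>, \<open>a\<^sub>n = E |exp (L / n)|\<^sup>2\<close> and \<open>b\<^sub>n = |E exp (L / n)|\<^sup>2\<close>. Independence gives
  \<open>Var G\<^sub>n = a\<^sub>n ^ n - b\<^sub>n ^ n\<close>, which lies between \<open>n (a\<^sub>n - b\<^sub>n) b\<^sub>n ^ (n - 1)\<close> and
  \<open>n (a\<^sub>n - b\<^sub>n) a\<^sub>n ^ (n - 1)\<close>. Both \<open>n (a\<^sub>n - 1)\<close> and \<open>n (b\<^sub>n - 1)\<close> tend to \<open>2 E[Re L]\<close>, so both powers
  tend to \<open>exp (2 E[Re L])\<close>, while \<open>n\<^sup>2 (a\<^sub>n - b\<^sub>n)\<close> is the variance of \<open>n (exp (L / n) - 1)\<close>. That variance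
  tends to \<open>Var L\<close>: by dominated convergence if \<open>Var L\<close> is finite, and by Fatou's lemma otherwise.\<close>

section \<open>Elementary estimates for exponentials and powers\<close>

text \<open>Mean value inequality on a half plane, which is convex and contains both
  \<open>0\<close> and \<open>w\<close>, and on which the derivative of \<open>exp\<close> has
  modulus at most \<open>exp (max 0 (Re w))\<close>. With \<open>max 0 (Re w)\<close> in place of
  \<open>cmod w\<close> the bound stays linear in \<open>cmod w\<close> when \<open>Re w\<close> is
  very negative; there the logarithm is known only to be integrable.\<close>

lemma norm_exp_minus_1_le:
  fixes w :: complex
  shows "cmod (exp w - 1) \<le> cmod w * exp (max 0 (Re w))"
proof -
  have "norm (exp w - exp 0) \<le> exp (max 0 (Re w)) * norm (w - 0)"
  proof (rule field_differentiable_bound[where S = "{z. Re z \<le> max 0 (Re w)}" and f' = exp])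
    show "convex {z. Re z \<le> max 0 (Re w)}"
      by (rule convex_halfspace_Re_le)
    show "(exp has_field_derivative exp z) (at z within {z. Re z \<le> max 0 (Re w)})" for z :: complex
      by (rule has_field_derivative_at_within[OF DERIV_exp])
  qed auto
  then show ?thesis
    by (simp add: mult.commute)
qed

text \<open>This is the derivative of \<open>exp (w * t)\<close> at \<open>t = 0\<close>, read along
  \<open>t = 1 / n\<close>.\<close>

lemma tendsto_scaled_exp_minus_1:
  fixes w :: complex
  shows "(\<lambda>n. of_nat n * (exp (w / of_nat n) - 1)) \<longlonglongrightarrow> w"
proof -
  have "((\<lambda>t. exp (w * t)) has_field_derivative w) (at 0)"
    by (auto intro!: derivative_eq_intros)
  then have "((\<lambda>t. (exp (w * t) - 1) / t) \<longlongrightarrow> w) (at 0)"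
    by (simp add: has_field_derivative_iff)
  moreover have "filterlim (\<lambda>n. inverse (of_nat n :: complex)) (at 0) sequentially"
    unfolding filterlim_at
    by (auto intro!: lim_inverse_n eventually_sequentiallyI[of 1])
  ultimately have "(\<lambda>n. (exp (w * inverse (of_nat n)) - 1) / inverse (of_nat n)) \<longlonglongrightarrow> w"
    by (rule filterlim_compose)
  then show ?thesis
    by (simp add: field_simps)
qed

text \<open>The bounds \<open>1 - 1 / x <= ln x <= x - 1\<close> squeeze \<open>n * ln (a n)\<close>
  to \<open>c\<close>. The exponent is \<open>n - 1\<close>, as in the bounds for differences of
  powers; the missing factor \<open>a n\<close> tends to \<open>1\<close>.\<close>

lemma power_tendsto_exp:
  fixes a :: "nat \<Rightarrow> real"
  assumes lim: "(\<lambda>n. of_nat n * (a n - 1)) \<longlonglongrightarrow> c"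
  shows "(\<lambda>n. a n ^ (n - 1)) \<longlonglongrightarrow> exp c"
proof -
  \<comment> \<open>Convergence of \<open>n * (a n - 1)\<close> already forces \<open>a n\<close> to
    tend to \<open>1\<close>; hence \<open>a n\<close> is eventually positive and its logarithm is
    meaningful.\<close>
  have "(\<lambda>n. inverse (of_nat n) * (of_nat n * (a n - 1))) \<longlonglongrightarrow> 0 * c"
    by (intro tendsto_mult lim lim_inverse_n)
  moreover have "\<forall>\<^sub>F n in sequentially. inverse (of_nat n) * (of_nat n * (a n - 1)) = a n - 1"
    using eventually_gt_at_top[of 0] by eventually_elim simp
  ultimately have "(\<lambda>n. a n - 1) \<longlonglongrightarrow> 0"
    using Lim_transform_eventually by fastforce
  then have a1: "a \<longlonglongrightarrow> 1"
    by (simp add: LIM_zero_iff)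
  then have pos: "\<forall>\<^sub>F n in sequentially. 0 < a n"
    by (rule order_tendstoD) simp
  have "(\<lambda>n. of_nat n * ln (a n)) \<longlonglongrightarrow> c"
  proof (rule tendsto_sandwich)
    show "\<forall>\<^sub>F n in sequentially. of_nat n * (a n - 1) / a n \<le> of_nat n * ln (a n)"
      using pos
    proof eventually_elim
      case (elim n)
      have "ln (inverse (a n)) \<le> inverse (a n) - 1"
        using elim by (intro ln_le_minus_one) simp
      then have "(a n - 1) / a n \<le> ln (a n)"
        using elim by (simp add: ln_inverse diff_divide_distrib inverse_eq_divide ln_div)
      then show ?case
        using mult_left_mono[of "(a n - 1) / a n" "ln (a n)" "of_nat n"] by simp
    qed
    show "\<forall>\<^sub>F n in sequentially. of_nat n * ln (a n) \<le> of_nat n * (a n - 1)"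
      using pos by eventually_elim (intro mult_left_mono ln_le_minus_one, auto)
    show "(\<lambda>n. of_nat n * (a n - 1) / a n) \<longlonglongrightarrow> c"
      using tendsto_divide[OF lim a1] by simp
  qed (rule lim)
  then have "(\<lambda>n. exp (of_nat n * ln (a n)) / a n) \<longlonglongrightarrow> exp c / 1"
    by (intro tendsto_divide tendsto_exp a1) auto
  then have "(\<lambda>n. exp (of_nat n * ln (a n)) / a n) \<longlonglongrightarrow> exp c"
    by simp
  moreover have "\<forall>\<^sub>F n in sequentially. exp (of_nat n * ln (a n)) / a n = a n ^ (n - 1)"
    using pos eventually_gt_at_top[of 0]
    by eventually_elim (simp add: exp_of_nat_mult power_diff)
  ultimately show ?thesis
    by (rule Lim_transform_eventually)
qed

text \<open>After the factor \<open>a - b\<close> is split off, each of the \<open>n\<close>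
  remaining summands lies between \<open>b ^ (n - 1)\<close> and \<open>a ^ (n - 1)\<close>.\<close>

lemma power_diff_bounds:
  fixes a b :: real
  assumes "0 \<le> b" "b \<le> a"
  shows "of_nat n * (a - b) * b ^ (n - 1) \<le> a ^ n - b ^ n"
    and "a ^ n - b ^ n \<le> of_nat n * (a - b) * a ^ (n - 1)"
proof -
  have eq: "a ^ n - b ^ n = (a - b) * (\<Sum>i<n. b ^ (n - Suc i) * a ^ i)"
    by (rule power_diff_sumr2)
  have split: "c ^ (n - 1) = c ^ (n - Suc i) * c ^ i" if "i < n" for c :: real and i
    using that by (simp flip: power_add)
  have "(\<Sum>i<n. b ^ (n - 1)) \<le> (\<Sum>i<n. b ^ (n - Suc i) * a ^ i)"
    using assms by (intro sum_mono) (simp add: split[of _ b] mult_left_mono power_mono del: One_nat_def)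
  then show "of_nat n * (a - b) * b ^ (n - 1) \<le> a ^ n - b ^ n"
    unfolding eq using mult_left_mono[of _ _ "a - b"] assms by (fastforce simp: mult_ac)
  have "(\<Sum>i<n. b ^ (n - Suc i) * a ^ i) \<le> (\<Sum>i<n. a ^ (n - 1))"
    using assms by (intro sum_mono) (simp add: split[of _ a] mult_right_mono power_mono del: One_nat_def)
  then show "a ^ n - b ^ n \<le> of_nat n * (a - b) * a ^ (n - 1)"
    unfolding eq using mult_left_mono[of _ _ "a - b"] assms by (fastforce simp: mult_ac)
qed

section \<open>The logarithm cut along the negative imaginary axis\<close>

lemma arg_cut_bounds:
  assumes "z \<noteq> 0"
  shows "- pi / 2 \<le> arg_cut z" "arg_cut z < 3 * pi / 2"
  using Arg2pi_ge_0[of "\<i> * z"] Arg2pi_lt_2pi[of "\<i> * z"] arg_cut_Arg2pi[OF assms] by auto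

lemma Re_log_cut [simp]: "Re (log_cut z) = ln (cmod z)"
  by (simp add: log_cut_def)

text \<open>The dummy value \<open>0\<close> at the origin obeys the bound as well, so it can be
  used at every point and not only almost everywhere.\<close>

lemma abs_Im_log_cut_le: "\<bar>Im (log_cut z)\<bar> \<le> 3 * pi / 2"
  using arg_cut_bounds[of z] pi_gt_zero by (cases "z = 0") (auto simp: log_cut_def)

text \<open>Multiplication by \<open>- \<i>\<close> turns the closed upper half plane into the
  closed right half plane, which meets the cut of \<open>Ln\<close> only at the origin. This makes
  the continuity of \<open>Ln\<close> available for \<open>log_cut\<close>.\<close>

lemma log_cut_eq_Ln:
  assumes "z \<noteq> 0" "Im z \<ge> 0"
  shows "log_cut z = Ln (- \<i> * z) + \<i> * of_real (pi / 2)"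
proof -
  let ?w = "- \<i> * z"
  have w: "?w \<noteq> 0" "0 \<le> Re ?w"
    using assms by auto
  \<comment> \<open>After the rotation back by \<open>pi / 2\<close> the angle lies between
    \<open>0\<close> and \<open>pi\<close>, well inside the range that determines
    \<open>arg_cut\<close>.\<close>
  have Im: "\<bar>Im (Ln ?w)\<bar> \<le> pi / 2"
    using Re_Ln_pos_le[OF w(1)] w(2) by simp
  have "arg_cut z = Im (Ln ?w) + pi / 2"
  proof (rule arg_cut_eqI)
    have Ln: "Ln ?w = of_real (ln (cmod z)) + \<i> * of_real (Im (Ln ?w))"
      using w(1) by (intro complex_eqI) (auto simp: norm_mult)
    have "?w = exp (of_real (ln (cmod z)) + \<i> * of_real (Im (Ln ?w)))"
      using w(1) exp_Ln Ln by metis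
    also have "\<dots> = of_real (cmod z) * exp (\<i> * of_real (Im (Ln ?w)))"
      using assms(1) by (simp add: exp_add exp_of_real)
    finally have eq: "z = of_real (cmod z) * (exp (\<i> * of_real (Im (Ln ?w))) * \<i>)"
      by (simp add: complex_eq_iff)
    have "exp (\<i> * of_real (Im (Ln ?w))) * \<i> = exp (\<i> * of_real (Im (Ln ?w)) + \<i> * of_real pi / 2)"
      unfolding exp_add by (simp add: exp_eq_polar cis_conv_exp[symmetric])
    also have "\<i> * of_real (Im (Ln ?w)) + \<i> * of_real pi / 2 = \<i> * of_real (Im (Ln ?w) + pi / 2)"
      by (simp add: algebra_simps)
    finally show "z = of_real (cmod z) * exp (\<i> * of_real (Im (Ln ?w) + pi / 2))"
      using eq by simp
  qed (use assms(1) abs_le_D1[OF Im] abs_le_D2[OF Im] pi_gt_zero in linarith)+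
  then show ?thesis
    using assms w by (intro complex_eqI) (auto simp: log_cut_def norm_mult)
qed

text \<open>The line of all \<open>x + \<alpha>\<close> can meet the origin only at
  \<open>x = - Re \<alpha>\<close>; elsewhere the function is continuous, and one exceptional point
  does not affect measurability.\<close>

lemma borel_measurable_log_cut_shift:
  assumes "Im \<alpha> \<ge> 0"
  shows "(\<lambda>x. log_cut (of_real x + \<alpha>)) \<in> borel_measurable borel"
proof (rule borel_measurable_continuous_countable_exceptions)
  show "countable {- Re \<alpha>}"
    by simp
  have ne: "of_real x + \<alpha> \<noteq> 0" if "x \<noteq> - Re \<alpha>" for x
    using that by (auto simp: complex_eq_iff)
  have nn: "- \<i> * (of_real x + \<alpha>) \<notin> \<real>\<^sub>\<le>\<^sub>0" if "x \<noteq> - Re \<alpha>" for x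
    using that assms by (auto simp: complex_nonpos_Reals_iff)
  have "continuous_on (- {- Re \<alpha>}) (\<lambda>x. Ln (- \<i> * (of_real x + \<alpha>)) + \<i> * of_real (pi / 2))"
    using nn by (intro continuous_intros) auto
  then show "continuous_on (- {- Re \<alpha>}) (\<lambda>x. log_cut (of_real x + \<alpha>))"
    by (rule continuous_on_eq) (simp add: log_cut_eq_Ln ne assms)
qed

section \<open>Variance of complex random variables\<close>

context prob_space
begin

text \<open>Serves twice: to discard the shift by \<alpha> in the geometric mean, and to extract
  \<open>n ^ 2\<close> from the variance of \<open>n * (exp (L / n) - 1)\<close>. As an equation in
  \<open>ennreal\<close> it covers infinite variance.\<close>

lemma cvariance_affine:
  assumes "integrable M Y"
  shows "cvariance M (\<lambda>\<omega>. c * (Y \<omega> - d)) = ennreal ((cmod c)\<^sup>2) * cvariance M Y"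
proof -
  have [measurable]: "Y \<in> borel_measurable M"
    using assms by auto
  have "cexpectation M (\<lambda>\<omega>. c * (Y \<omega> - d)) = c * (cexpectation M Y - d)"
    using assms by (simp add: cexpectation_eq_integral prob_space)
  then have "(cmod (c * (Y \<omega> - d) - cexpectation M (\<lambda>\<omega>. c * (Y \<omega> - d))))\<^sup>2
      = (cmod c)\<^sup>2 * (cmod (Y \<omega> - cexpectation M Y))\<^sup>2" for \<omega>
    by (simp flip: power_mult_distrib norm_mult add: algebra_simps)
  then show ?thesis
    by (simp add: cvariance_def ennreal_mult nn_integral_cmult)
qed

lemma square_norm_integrable_imp_integrable:
  fixes Y :: "'a \<Rightarrow> complex"
  assumes "Y \<in> borel_measurable M" "integrable M (\<lambda>\<omega>. (cmod (Y \<omega>))\<^sup>2)"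
  shows "integrable M Y"
  using square_integrable_imp_integrable[of "\<lambda>\<omega>. cmod (Y \<omega>)"] assms
  by (simp add: integrable_norm_iff)

text \<open>The second claim ensures that the difference inside \<open>ennreal\<close> is not
  truncated at \<open>0\<close>.\<close>

lemma cvariance_eq:
  assumes [measurable]: "Y \<in> borel_measurable M" and Y2: "integrable M (\<lambda>\<omega>. (cmod (Y \<omega>))\<^sup>2)"
  shows "cvariance M Y = ennreal ((\<integral>\<omega>. (cmod (Y \<omega>))\<^sup>2 \<partial>M) - (cmod (\<integral>\<omega>. Y \<omega> \<partial>M))\<^sup>2)"
    and "(cmod (\<integral>\<omega>. Y \<omega> \<partial>M))\<^sup>2 \<le> (\<integral>\<omega>. (cmod (Y \<omega>))\<^sup>2 \<partial>M)"
proof -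
  define m where "m = (\<integral>\<omega>. Y \<omega> \<partial>M)"
  have Y1: "integrable M Y"
    using assms by (rule square_norm_integrable_imp_integrable)
  \<comment> \<open>The cross term is written as the real part of a linear expression in
    \<open>Y\<close>, so that its integral is \<open>Re (cnj m * m)\<close>, the squared modulus of
    the mean.\<close>
  have eq: "(cmod (Y \<omega> - m))\<^sup>2 = (cmod (Y \<omega>))\<^sup>2 - 2 * Re (cnj m * Y \<omega>) + (cmod m)\<^sup>2" for \<omega>
    unfolding cmod_power2 by (simp add: power2_eq_square algebra_simps)
  have Y1': "integrable M (\<lambda>\<omega>. Re (cnj m * Y \<omega>))"
    using Y1 by (intro integrable_Re integrable_mult_right)
  have int: "integrable M (\<lambda>\<omega>. (cmod (Y \<omega> - m))\<^sup>2)"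
    unfolding eq using Y1' Y2 by (intro Bochner_Integration.integrable_add
      Bochner_Integration.integrable_diff integrable_mult_right) (assumption | rule integrable_const)+
  have "(\<integral>\<omega>. Re (cnj m * Y \<omega>) \<partial>M) = Re (cnj m * m)"
    unfolding m_def using Y1 by (subst integral_Re) auto
  also have "\<dots> = (cmod m)\<^sup>2"
    unfolding cmod_power2 by (simp add: power2_eq_square)
  finally have "(\<integral>\<omega>. (cmod (Y \<omega> - m))\<^sup>2 \<partial>M) = (\<integral>\<omega>. (cmod (Y \<omega>))\<^sup>2 \<partial>M) - (cmod m)\<^sup>2"
    unfolding eq using Y1' Y2 by (simp add: prob_space del: times_complex.sel)
  moreover have "cvariance M Y = ennreal (\<integral>\<omega>. (cmod (Y \<omega> - m))\<^sup>2 \<partial>M)"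
    unfolding cvariance_def cexpectation_eq_integral[OF Y1] m_def[symmetric]
    using int by (intro nn_integral_eq_integral) auto
  moreover have "0 \<le> (\<integral>\<omega>. (cmod (Y \<omega> - m))\<^sup>2 \<partial>M)"
    by simp
  ultimately show "cvariance M Y = ennreal ((\<integral>\<omega>. (cmod (Y \<omega>))\<^sup>2 \<partial>M) - (cmod (\<integral>\<omega>. Y \<omega> \<partial>M))\<^sup>2)"
    and "(cmod (\<integral>\<omega>. Y \<omega> \<partial>M))\<^sup>2 \<le> (\<integral>\<omega>. (cmod (Y \<omega>))\<^sup>2 \<partial>M)"
    by (auto simp: m_def)
qed

lemma cvariance_finite_imp_square_integrable:
  assumes [measurable]: "Y \<in> borel_measurable M" and fin: "cvariance M Y < \<infinity>"
  shows "integrable M (\<lambda>\<omega>. (cmod (Y \<omega>))\<^sup>2)"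
proof (rule Bochner_Integration.integrable_bound)
  \<comment> \<open>Only a fixed complex number is needed here. The argument does not presuppose
    that \<open>?m\<close> is a genuine mean, since integrability of \<open>Y\<close> is not yet
    known.\<close>
  let ?m = "cexpectation M Y"
  have "integrable M (\<lambda>\<omega>. (cmod (Y \<omega> - ?m))\<^sup>2)"
    using fin unfolding cvariance_def by (intro integrableI_nonneg) auto
  then show "integrable M (\<lambda>\<omega>. 2 * (cmod (Y \<omega> - ?m))\<^sup>2 + 2 * (cmod ?m)\<^sup>2)"
    by auto
  have "(cmod y)\<^sup>2 \<le> 2 * (cmod (y - ?m))\<^sup>2 + 2 * (cmod ?m)\<^sup>2" for y
  proof -
    have "(cmod y)\<^sup>2 \<le> (cmod (y - ?m) + cmod ?m)\<^sup>2"
      using norm_triangle_ineq[of "y - ?m" ?m] by (intro power_mono) auto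
    also have "\<dots> \<le> 2 * (cmod (y - ?m))\<^sup>2 + 2 * (cmod ?m)\<^sup>2"
      using sum_squares_bound[of "cmod (y - ?m)" "cmod ?m"] by (simp add: power2_sum)
    finally show ?thesis .
  qed
  then show "AE \<omega> in M. norm ((cmod (Y \<omega>))\<^sup>2) \<le> norm (2 * (cmod (Y \<omega> - ?m))\<^sup>2 + 2 * (cmod ?m)\<^sup>2)"
    by (intro AE_I2) (simp add: order.trans[OF _ abs_ge_self])
qed auto

section \<open>Moments of \<open>exp (L / n)\<close> for large \<open>n\<close>\<close>

text \<open>Supplies a majorant independent of \<open>n\<close> for dominated convergence. Where
  \<open>Re L\<close> is negative it is \<open>cmod L\<close>; where \<open>Re L\<close> is
  positive, \<open>cmod L\<close> is at most \<open>Re L + K\<close>, and an exponential moment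
  absorbs everything. Square integrability of \<open>W\<close> is conditional, because first moments
  are needed also when \<open>L\<close> has infinite variance.\<close>

lemma exp_increment_dominated:
  fixes L :: "'a \<Rightarrow> complex"
  assumes L: "integrable M L" and K: "\<And>\<omega>. \<bar>Im (L \<omega>)\<bar> \<le> K"
    and \<beta>: "\<beta> > 0" "integrable M (\<lambda>\<omega>. exp (\<beta> * Re (L \<omega>)))"
  obtains W :: "'a \<Rightarrow> real" and N :: nat where
    "N > 0" "integrable M W"
    "\<And>n \<omega>. n \<ge> N \<Longrightarrow> cmod (of_nat n * (exp (L \<omega> / of_nat n) - 1)) \<le> W \<omega>"
    "integrable M (\<lambda>\<omega>. (cmod (L \<omega>))\<^sup>2) \<Longrightarrow> integrable M (\<lambda>\<omega>. (W \<omega>)\<^sup>2)"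
proof -
  \<comment> \<open>For \<open>Re L > 0\<close> the majorant is at most
    \<open>C * exp (2 * \<delta> * Re L)\<close>, and squaring doubles the exponent to
    \<open>4 * \<delta> = \<beta>\<close>. In \<open>C\<close> the term \<open>1 / \<delta>\<close>
    comes from \<open>t <= exp (\<delta> * t) / \<delta>\<close>, and \<open>K\<close> from the
    imaginary part.\<close>
  define \<delta> where "\<delta> = \<beta> / 4"
  define C where "C = 1 / \<delta> + K"
  define W where "W = (\<lambda>\<omega>. cmod (L \<omega>) * exp (\<delta> * max 0 (Re (L \<omega>))))"
  \<comment> \<open>From \<open>N\<close> on, \<open>1 / n <= \<delta>\<close>, so the exponential
    factor in the bound for \<open>exp (L / n) - 1\<close> is below the one in
    \<open>W\<close>.\<close>
  define N where "N = nat \<lceil>1 / \<delta>\<rceil> + 1"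
  have [measurable]: "L \<in> borel_measurable M"
    using L by auto
  have \<delta>: "\<delta> > 0"
    using \<beta> by (simp add: \<delta>_def)
  have K0: "0 \<le> K"
    using K[of undefined] by linarith
  have C0: "0 \<le> C"
    using \<delta> K0 by (simp add: C_def)
  have W0: "0 \<le> W \<omega>" for \<omega>
    by (simp add: W_def)
  have W_pos: "W \<omega> \<le> C * exp (2 * \<delta> * Re (L \<omega>))" if "Re (L \<omega>) > 0" for \<omega>
  proof -
    let ?U = "Re (L \<omega>)"
    have "cmod (L \<omega>) \<le> ?U + K"
      using cmod_le[of "L \<omega>"] K[of \<omega>] that by simp
    also have "\<dots> \<le> exp (\<delta> * ?U) / \<delta> + K * exp (\<delta> * ?U)"
    proof (rule add_mono)
      have "\<delta> * ?U \<le> exp (\<delta> * ?U)"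
        using exp_ge_add_one_self[of "\<delta> * ?U"] by linarith
      then show "?U \<le> exp (\<delta> * ?U) / \<delta>"
        using \<delta> by (simp add: field_simps)
      show "K \<le> K * exp (\<delta> * ?U)"
        using K0 that \<delta> by (simp add: mult_le_cancel_left1)
    qed
    also have "\<dots> = C * exp (\<delta> * ?U)"
      by (simp add: C_def algebra_simps)
    finally have "W \<omega> \<le> C * exp (\<delta> * ?U) * exp (\<delta> * ?U)"
      using that by (simp add: W_def)
    also have "\<dots> = C * exp (2 * \<delta> * ?U)"
      by (simp flip: exp_add)
    finally show ?thesis .
  qed
  have W_nonpos: "W \<omega> = cmod (L \<omega>)" if "Re (L \<omega>) \<le> 0" for \<omega>
    using that by (simp add: W_def)
  have W1: "W \<omega> \<le> cmod (L \<omega>) + C * exp (\<beta> * Re (L \<omega>))" for \<omega>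
  proof (cases "Re (L \<omega>) > 0")
    case True
    then have "exp (2 * \<delta> * Re (L \<omega>)) \<le> exp (\<beta> * Re (L \<omega>))"
      using \<beta> by (simp add: \<delta>_def)
    then have "C * exp (2 * \<delta> * Re (L \<omega>)) \<le> C * exp (\<beta> * Re (L \<omega>))"
      using C0 by (intro mult_left_mono)
    then show ?thesis
      using W_pos[OF True] norm_ge_zero[of "L \<omega>"] by linarith
  qed (use C0 in \<open>simp add: W_nonpos\<close>)
  have W2: "(W \<omega>)\<^sup>2 \<le> (cmod (L \<omega>))\<^sup>2 + C\<^sup>2 * exp (\<beta> * Re (L \<omega>))" for \<omega>
  proof (cases "Re (L \<omega>) > 0")
    case True
    have "(W \<omega>)\<^sup>2 \<le> (C * exp (2 * \<delta> * Re (L \<omega>)))\<^sup>2"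
      using W_pos[OF True] W0 by (intro power_mono)
    also have "\<dots> = C\<^sup>2 * exp (\<beta> * Re (L \<omega>))"
      by (simp add: power_mult_distrib \<delta>_def flip: exp_double)
    finally show ?thesis
      by (simp add: add_increasing)
  qed (simp add: W_nonpos)
  show ?thesis
  proof
    show "N > 0"
      by (simp add: N_def)
    show "integrable M W"
    proof (rule Bochner_Integration.integrable_bound)
      show "integrable M (\<lambda>\<omega>. cmod (L \<omega>) + C * exp (\<beta> * Re (L \<omega>)))"
        using L \<beta> by auto
    qed (use W0 W1 in \<open>auto simp: W_def[abs_def] intro!: AE_I2 order.trans[OF _ abs_ge_self]\<close>)
    show "integrable M (\<lambda>\<omega>. (W \<omega>)\<^sup>2)" if "integrable M (\<lambda>\<omega>. (cmod (L \<omega>))\<^sup>2)"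
    proof (rule Bochner_Integration.integrable_bound)
      show "integrable M (\<lambda>\<omega>. (cmod (L \<omega>))\<^sup>2 + C\<^sup>2 * exp (\<beta> * Re (L \<omega>)))"
        using that \<beta> by auto
      show "(\<lambda>\<omega>. (W \<omega>)\<^sup>2) \<in> borel_measurable M"
        by (simp add: W_def)
    qed (use W2 in \<open>auto intro!: AE_I2 order.trans[OF _ abs_ge_self]\<close>)
    show "cmod (of_nat n * (exp (L \<omega> / of_nat n) - 1)) \<le> W \<omega>" if "n \<ge> N" for n \<omega>
    proof -
      have n: "n > 0" "1 / \<delta> \<le> real n"
        using that unfolding N_def by linarith+
      have "max 0 (Re (L \<omega> / of_nat n)) = (1 / real n) * max 0 (Re (L \<omega>))"
        using n by (simp add: max_def Re_divide_of_nat field_simps)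
      also have "\<dots> \<le> \<delta> * max 0 (Re (L \<omega>))"
        using n \<delta> by (intro mult_right_mono) (auto simp: field_simps)
      finally have le: "max 0 (Re (L \<omega> / of_nat n)) \<le> \<delta> * max 0 (Re (L \<omega>))" .
      have "cmod (of_nat n * (exp (L \<omega> / of_nat n) - 1)) = real n * cmod (exp (L \<omega> / of_nat n) - 1)"
        by (simp add: norm_mult)
      also have "\<dots> \<le> real n * (cmod (L \<omega> / of_nat n) * exp (max 0 (Re (L \<omega> / of_nat n))))"
        by (intro mult_left_mono norm_exp_minus_1_le) auto
      also have "\<dots> = cmod (L \<omega>) * exp (max 0 (Re (L \<omega> / of_nat n)))"
        using n by (simp add: norm_divide)
      also have "\<dots> \<le> W \<omega>"
        using le unfolding W_def by (intro mult_left_mono) auto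
      finally show ?thesis .
    qed
  qed
qed

lemma expectation_scaled_exp:
  fixes L :: "'a \<Rightarrow> complex"
  assumes L: "integrable M L" and K: "\<And>\<omega>. \<bar>Im (L \<omega>)\<bar> \<le> K"
    and \<beta>: "\<beta> > 0" "integrable M (\<lambda>\<omega>. exp (\<beta> * Re (L \<omega>)))"
  shows "\<forall>\<^sub>F n in sequentially. integrable M (\<lambda>\<omega>. exp (L \<omega> / of_nat n))"
    and "(\<lambda>n. \<integral>\<omega>. of_nat n * (exp (L \<omega> / of_nat n) - 1) \<partial>M) \<longlonglongrightarrow> (\<integral>\<omega>. L \<omega> \<partial>M)"
    and "(\<lambda>n. of_nat n * ((\<integral>\<omega>. exp (L \<omega> / of_nat n) \<partial>M) - 1)) \<longlonglongrightarrow> (\<integral>\<omega>. L \<omega> \<partial>M)"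
    and "integrable M (\<lambda>\<omega>. (cmod (L \<omega>))\<^sup>2) \<Longrightarrow>
      (\<lambda>n. \<integral>\<omega>. (cmod (of_nat n * (exp (L \<omega> / of_nat n) - 1)))\<^sup>2 \<partial>M) \<longlonglongrightarrow> (\<integral>\<omega>. (cmod (L \<omega>))\<^sup>2 \<partial>M)"
proof -
  let ?Y = "\<lambda>n \<omega>. of_nat n * (exp (L \<omega> / of_nat n) - 1)"
  have [measurable]: "L \<in> borel_measurable M"
    using L by auto
  obtain W N where W: "N > 0" "integrable M W" "\<And>n \<omega>. n \<ge> N \<Longrightarrow> cmod (?Y n \<omega>) \<le> W \<omega>"
    "integrable M (\<lambda>\<omega>. (cmod (L \<omega>))\<^sup>2) \<Longrightarrow> integrable M (\<lambda>\<omega>. (W \<omega>)\<^sup>2)"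
    by (rule exp_increment_dominated[OF assms]) blast
  \<comment> \<open>The majorant is valid only from \<open>N\<close> on, so dominated convergence is
    applied along \<open>n + N\<close> and the shift is undone afterwards.\<close>
  have lim: "(\<lambda>n. ?Y (n + N) \<omega>) \<longlonglongrightarrow> L \<omega>" for \<omega>
    using tendsto_scaled_exp_minus_1 by (rule LIMSEQ_ignore_initial_segment)
  have int: "integrable M (\<lambda>\<omega>. exp (L \<omega> / of_nat n))" if "n \<ge> N" for n
  proof -
    have "integrable M (?Y n)"
      using W(2) by (rule Bochner_Integration.integrable_bound)
        (use W(3)[OF that] in \<open>auto intro!: AE_I2 order.trans[OF _ abs_ge_self]\<close>)
    then have "integrable M (\<lambda>\<omega>. ?Y n \<omega> / of_nat n + 1)"
      by (intro Bochner_Integration.integrable_add integrable_divide) auto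
    then show ?thesis
      using W(1) that by simp
  qed
  then show ev: "\<forall>\<^sub>F n in sequentially. integrable M (\<lambda>\<omega>. exp (L \<omega> / of_nat n))"
    by (rule eventually_sequentiallyI)
  have "(\<lambda>n. \<integral>\<omega>. ?Y (n + N) \<omega> \<partial>M) \<longlonglongrightarrow> (\<integral>\<omega>. L \<omega> \<partial>M)"
  proof (rule integral_dominated_convergence[OF _ _ W(2)])
    show "AE \<omega> in M. (\<lambda>n. ?Y (n + N) \<omega>) \<longlonglongrightarrow> L \<omega>"
      by (intro AE_I2 lim)
    show "AE \<omega> in M. cmod (?Y (n + N) \<omega>) \<le> W \<omega>" for n
      using W(3)[of "n + N"] by (intro AE_I2) simp
  qed auto
  then show *: "(\<lambda>n. \<integral>\<omega>. ?Y n \<omega> \<partial>M) \<longlonglongrightarrow> (\<integral>\<omega>. L \<omega> \<partial>M)"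
    by (rule LIMSEQ_offset)
  \<comment> \<open>Linearity of the integral is available here once \<open>exp (L / n)\<close> is
    integrable, hence only eventually.\<close>
  have "\<forall>\<^sub>F n in sequentially. (\<integral>\<omega>. ?Y n \<omega> \<partial>M) = of_nat n * ((\<integral>\<omega>. exp (L \<omega> / of_nat n) \<partial>M) - 1)"
    using ev by eventually_elim (simp add: prob_space)
  with * show "(\<lambda>n. of_nat n * ((\<integral>\<omega>. exp (L \<omega> / of_nat n) \<partial>M) - 1)) \<longlonglongrightarrow> (\<integral>\<omega>. L \<omega> \<partial>M)"
    by (rule Lim_transform_eventually)
  assume "integrable M (\<lambda>\<omega>. (cmod (L \<omega>))\<^sup>2)"
  then have W2: "integrable M (\<lambda>\<omega>. (W \<omega>)\<^sup>2)"
    by (rule W(4))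
  have "(\<lambda>n. \<integral>\<omega>. (cmod (?Y (n + N) \<omega>))\<^sup>2 \<partial>M) \<longlonglongrightarrow> (\<integral>\<omega>. (cmod (L \<omega>))\<^sup>2 \<partial>M)"
  proof (rule integral_dominated_convergence[OF _ _ W2])
    show "AE \<omega> in M. (\<lambda>n. (cmod (?Y (n + N) \<omega>))\<^sup>2) \<longlonglongrightarrow> (cmod (L \<omega>))\<^sup>2"
      by (intro AE_I2 tendsto_power tendsto_norm lim)
    show "AE \<omega> in M. norm ((cmod (?Y (n + N) \<omega>))\<^sup>2) \<le> (W \<omega>)\<^sup>2" for n
      using W(3)[of "n + N"] by (intro AE_I2) (simp add: power_mono)
  qed auto
  then show "(\<lambda>n. \<integral>\<omega>. (cmod (?Y n \<omega>))\<^sup>2 \<partial>M) \<longlonglongrightarrow> (\<integral>\<omega>. (cmod (L \<omega>))\<^sup>2 \<partial>M)"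
    by (rule LIMSEQ_offset)
qed

text \<open>The squared modulus of \<open>exp (L / n)\<close> is \<open>exp (2 * Re L / n)\<close>,
  so the preceding limits apply to the real variable \<open>2 * Re L\<close>, with imaginary bound
  \<open>0\<close> and with \<open>\<beta> / 2\<close> in place of \<beta>.\<close>

lemma exp_square_norm_expectation:
  fixes L :: "'a \<Rightarrow> complex"
  assumes L: "integrable M L"
    and \<beta>: "\<beta> > 0" "integrable M (\<lambda>\<omega>. exp (\<beta> * Re (L \<omega>)))"
  shows "\<forall>\<^sub>F n in sequentially. integrable M (\<lambda>\<omega>. (cmod (exp (L \<omega> / of_nat n)))\<^sup>2)"
    and "(\<lambda>n. of_nat n * ((\<integral>\<omega>. (cmod (exp (L \<omega> / of_nat n)))\<^sup>2 \<partial>M) - 1))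
      \<longlonglongrightarrow> 2 * (\<integral>\<omega>. Re (L \<omega>) \<partial>M)"
proof -
  let ?L' = "\<lambda>\<omega>. complex_of_real (2 * Re (L \<omega>))"
  have L': "integrable M ?L'"
    using L by (intro integrable_of_real integrable_mult_right integrable_Re)
  have \<beta>': "0 < \<beta> / 2" "integrable M (\<lambda>\<omega>. exp (\<beta> / 2 * Re (?L' \<omega>)))"
    using \<beta> by auto
  have eq: "exp (?L' \<omega> / of_nat n) = of_real ((cmod (exp (L \<omega> / of_nat n)))\<^sup>2)" for n \<omega>
    by (simp add: Re_divide_of_nat exp_of_real[symmetric] flip: exp_double)
  note lim = expectation_scaled_exp[OF L' _ \<beta>', of 0, unfolded eq]
  show "\<forall>\<^sub>F n in sequentially. integrable M (\<lambda>\<omega>. (cmod (exp (L \<omega> / of_nat n)))\<^sup>2)"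
    using lim(1) unfolding complex_of_real_integrable_eq by simp
  have "(\<lambda>n. Re (of_nat n * ((\<integral>\<omega>. complex_of_real ((cmod (exp (L \<omega> / of_nat n)))\<^sup>2) \<partial>M) - 1)))
      \<longlonglongrightarrow> Re (\<integral>\<omega>. ?L' \<omega> \<partial>M)"
    by (intro tendsto_Re lim(3)) simp
  then show "(\<lambda>n. of_nat n * ((\<integral>\<omega>. (cmod (exp (L \<omega> / of_nat n)))\<^sup>2 \<partial>M) - 1))
      \<longlonglongrightarrow> 2 * (\<integral>\<omega>. Re (L \<omega>) \<partial>M)"
    by (simp del: of_real_power norm_exp_eq_Re)
qed

text \<open>Writing the mean of \<open>exp (L / n)\<close> as \<open>1 + c n / n\<close>, where
  \<open>c n\<close> tends to the mean of \<open>L\<close>, the scaled difference equals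
  \<open>2 * Re (c n)\<close> plus the square of \<open>cmod (c n)\<close> divided by
  \<open>n\<close>, and the last term vanishes in the limit.\<close>

lemma exp_expectation_square_norm:
  fixes L :: "'a \<Rightarrow> complex"
  assumes "integrable M L" "\<And>\<omega>. \<bar>Im (L \<omega>)\<bar> \<le> K"
    and "\<beta> > 0" "integrable M (\<lambda>\<omega>. exp (\<beta> * Re (L \<omega>)))"
  shows "(\<lambda>n. of_nat n * ((cmod (\<integral>\<omega>. exp (L \<omega> / of_nat n) \<partial>M))\<^sup>2 - 1))
      \<longlonglongrightarrow> 2 * (\<integral>\<omega>. Re (L \<omega>) \<partial>M)"
proof -
  let ?e = "\<lambda>n. \<integral>\<omega>. exp (L \<omega> / of_nat n) \<partial>M"
  define c where "c = (\<lambda>n. of_nat n * (?e n - 1))"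
  have c: "c \<longlonglongrightarrow> (\<integral>\<omega>. L \<omega> \<partial>M)"
    unfolding c_def by (rule expectation_scaled_exp[OF assms])
  have "Re (\<integral>\<omega>. L \<omega> \<partial>M) = (\<integral>\<omega>. Re (L \<omega>) \<partial>M)"
    using assms(1) by simp
  moreover have "(\<lambda>n. 2 * Re (c n) + (cmod (c n))\<^sup>2 * inverse (of_nat n))
      \<longlonglongrightarrow> 2 * Re (\<integral>\<omega>. L \<omega> \<partial>M) + (cmod (\<integral>\<omega>. L \<omega> \<partial>M))\<^sup>2 * 0"
    by (intro tendsto_intros c lim_inverse_n)
  moreover have "\<forall>\<^sub>F n in sequentially.
      2 * Re (c n) + (cmod (c n))\<^sup>2 * inverse (of_nat n) = of_nat n * ((cmod (?e n))\<^sup>2 - 1)"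
    using eventually_gt_at_top[of 0]
  proof eventually_elim
    case (elim n)
    have "(cmod (?e n))\<^sup>2 - 1 = (cmod (?e n - 1))\<^sup>2 + 2 * Re (?e n - 1)"
      unfolding cmod_power2 by (simp add: power2_eq_square algebra_simps)
    moreover have "(cmod (c n))\<^sup>2 * inverse (of_nat n) = of_nat n * (cmod (?e n - 1))\<^sup>2"
      using elim by (simp add: c_def norm_mult power_mult_distrib power2_eq_square)
    moreover have "Re (c n) = of_nat n * Re (?e n - 1)"
      by (simp add: c_def)
    ultimately show ?case
      by (simp only: distrib_left add.commute mult.left_commute)
  qed
  ultimately show ?thesis
    by (simp only: mult_zero_right add_0_right tendsto_cong)
qed

lemma cvariance_scaled_exp_tendsto:
  fixes L :: "'a \<Rightarrow> complex"
  assumes L: "integrable M L" and K: "\<And>\<omega>. \<bar>Im (L \<omega>)\<bar> \<le> K"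
    and \<beta>: "\<beta> > 0" "integrable M (\<lambda>\<omega>. exp (\<beta> * Re (L \<omega>)))"
  shows "(\<lambda>n. cvariance M (\<lambda>\<omega>. of_nat n * (exp (L \<omega> / of_nat n) - 1))) \<longlonglongrightarrow> cvariance M L"
proof -
  let ?Y = "\<lambda>n \<omega>. of_nat n * (exp (L \<omega> / of_nat n) - 1)"
  note lims = expectation_scaled_exp[OF assms]
  have [measurable]: "L \<in> borel_measurable M"
    using L by auto
  show ?thesis
  proof (cases "cvariance M L < \<infinity>")
    case True
    then have L2: "integrable M (\<lambda>\<omega>. (cmod (L \<omega>))\<^sup>2)"
      by (intro cvariance_finite_imp_square_integrable) auto
    have "(\<lambda>n. ennreal ((\<integral>\<omega>. (cmod (?Y n \<omega>))\<^sup>2 \<partial>M) - (cmod (\<integral>\<omega>. ?Y n \<omega> \<partial>M))\<^sup>2)) \<longlonglongrightarrow> cvariance M L"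
      unfolding cvariance_eq(1)[OF \<open>L \<in> borel_measurable M\<close> L2]
      by (intro tendsto_ennrealI tendsto_diff tendsto_power tendsto_norm lims L2)
    moreover have "\<forall>\<^sub>F n in sequentially.
        ennreal ((\<integral>\<omega>. (cmod (?Y n \<omega>))\<^sup>2 \<partial>M) - (cmod (\<integral>\<omega>. ?Y n \<omega> \<partial>M))\<^sup>2) = cvariance M (?Y n)"
      using exp_square_norm_expectation(1)[OF L \<beta>] lims(1)
    proof eventually_elim
      case (elim n)
      \<comment> \<open>Square integrability passes from \<open>exp (L / n)\<close> to
        \<open>?Y n\<close> by way of the variance, whose finiteness survives affine maps.\<close>
      have "cvariance M (?Y n) < \<infinity>"
        using elim by (simp add: cvariance_affine cvariance_eq ennreal_mult_less_top)
      then have "integrable M (\<lambda>\<omega>. (cmod (?Y n \<omega>))\<^sup>2)"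
        by (intro cvariance_finite_imp_square_integrable) auto
      then show ?case
        by (intro cvariance_eq(1)[symmetric]) auto
    qed
    ultimately show ?thesis
      by (rule Lim_transform_eventually)
  next
    case False
    let ?u = "\<lambda>n \<omega>. ennreal ((cmod (?Y n \<omega> - cexpectation M (?Y n)))\<^sup>2)"
    \<comment> \<open>The centring constants depend on \<open>n\<close>; their convergence is needed
      before the centred squares converge pointwise and Fatou's lemma applies.\<close>
    have "\<forall>\<^sub>F n in sequentially. (\<integral>\<omega>. ?Y n \<omega> \<partial>M) = cexpectation M (?Y n)"
      using lims(1) by eventually_elim (simp add: cexpectation_eq_integral)
    then have "(\<lambda>n. cexpectation M (?Y n)) \<longlonglongrightarrow> cexpectation M L"
      using lims(2) unfolding cexpectation_eq_integral[OF L] by (rule Lim_transform_eventually[rotated])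
    then have "(\<lambda>n. ?u n \<omega>) \<longlonglongrightarrow> ennreal ((cmod (L \<omega> - cexpectation M L))\<^sup>2)" for \<omega>
      by (intro tendsto_ennrealI tendsto_power tendsto_norm tendsto_diff tendsto_scaled_exp_minus_1)
    then have "liminf (\<lambda>n. ?u n \<omega>) = ennreal ((cmod (L \<omega> - cexpectation M L))\<^sup>2)" for \<omega>
      by (intro lim_imp_Liminf) auto
    then have "cvariance M L = (\<integral>\<^sup>+\<omega>. liminf (\<lambda>n. ?u n \<omega>) \<partial>M)"
      by (simp add: cvariance_def)
    also have "\<dots> \<le> liminf (\<lambda>n. \<integral>\<^sup>+\<omega>. ?u n \<omega> \<partial>M)"
      by (rule nn_integral_liminf) simp
    also have "\<dots> = liminf (\<lambda>n. cvariance M (?Y n))"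
      by (simp add: cvariance_def)
    finally have "cvariance M L \<le> liminf (\<lambda>n. cvariance M (?Y n))" .
    moreover from False have top: "cvariance M L = top"
      by (simp add: less_top[symmetric])
    ultimately have "liminf (\<lambda>n. cvariance M (?Y n)) = top"
      by (simp add: top_unique)
    then show ?thesis
      unfolding top by (intro order_tendstoI less_LiminfD) auto
  qed
qed

section \<open>Products of independent factors and the squeeze\<close>

lemma cvariance_iid_prod:
  fixes X :: "nat \<Rightarrow> 'a \<Rightarrow> real" and f :: "real \<Rightarrow> complex"
  assumes indep: "indep_vars (\<lambda>_. borel) X {1..}"
    and ident: "\<And>i. i \<ge> 1 \<Longrightarrow> distr M borel (X i) = distr M borel (X 1)"
    and f[measurable]: "f \<in> borel_measurable borel"
    and f2: "integrable M (\<lambda>\<omega>. (cmod (f (X 1 \<omega>)))\<^sup>2)"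
  shows "integrable M (\<lambda>\<omega>. \<Prod>j=1..n. f (X j \<omega>))"
    and "cvariance M (\<lambda>\<omega>. \<Prod>j=1..n. f (X j \<omega>)) =
      ennreal ((\<integral>\<omega>. (cmod (f (X 1 \<omega>)))\<^sup>2 \<partial>M) ^ n - ((cmod (\<integral>\<omega>. f (X 1 \<omega>) \<partial>M))\<^sup>2) ^ n)"
proof -
  have X[measurable]: "X i \<in> borel_measurable M" if "i \<ge> 1" for i
    using indep that by (auto simp: indep_vars_def)
  have transfer: "integrable M (\<lambda>\<omega>. g (X i \<omega>))" "(\<integral>\<omega>. g (X i \<omega>) \<partial>M) = (\<integral>\<omega>. g (X 1 \<omega>) \<partial>M)"
    if "i \<ge> 1" "g \<in> borel_measurable borel" "integrable M (\<lambda>\<omega>. g (X 1 \<omega>))"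
    for i and g :: "real \<Rightarrow> 'c :: {banach, second_countable_topology}"
  proof -
    have "integrable (distr M borel (X 1)) g"
      using that by (subst integrable_distr_eq) auto
    then show "integrable M (\<lambda>\<omega>. g (X i \<omega>))"
      using that unfolding ident[OF that(1), symmetric] by (subst (asm) integrable_distr_eq) auto
    have "(\<integral>\<omega>. g (X i \<omega>) \<partial>M) = integral\<^sup>L (distr M borel (X i)) g"
      using that by (subst integral_distr) auto
    also have "\<dots> = (\<integral>\<omega>. g (X 1 \<omega>) \<partial>M)"
      unfolding ident[OF that(1)] using that by (subst integral_distr) auto
    finally show "(\<integral>\<omega>. g (X i \<omega>) \<partial>M) = (\<integral>\<omega>. g (X 1 \<omega>) \<partial>M)" .
  qed
  \<comment> \<open>The value type of \<open>g\<close> is left open, since the fact is applied both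
    to the complex \<open>f\<close> and to its real squared modulus.\<close>
  have prod: "integrable M (\<lambda>\<omega>. \<Prod>j=1..n. g (X j \<omega>))"
    "(\<integral>\<omega>. (\<Prod>j=1..n. g (X j \<omega>)) \<partial>M) = (\<integral>\<omega>. g (X 1 \<omega>) \<partial>M) ^ n"
    if g: "g \<in> borel_measurable borel" "integrable M (\<lambda>\<omega>. g (X 1 \<omega>))"
    for g :: "real \<Rightarrow> 'c :: {real_normed_field, banach, second_countable_topology}"
  proof -
    have "indep_vars (\<lambda>_. borel) (\<lambda>j \<omega>. g (X j \<omega>)) {1..n}"
      using indep_vars_compose2[OF indep_vars_subset[OF indep, of "{1..n}"], of "\<lambda>_. g"] g by auto
    note * = finite_atLeastAtMost this transfer(1)[OF _ g]
    show "integrable M (\<lambda>\<omega>. \<Prod>j=1..n. g (X j \<omega>))"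
      by (rule indep_vars_integrable[OF *]) auto
    have "(\<integral>\<omega>. (\<Prod>j=1..n. g (X j \<omega>)) \<partial>M) = (\<Prod>j=1..n. \<integral>\<omega>. g (X j \<omega>) \<partial>M)"
      by (rule indep_vars_lebesgue_integral[OF *]) auto
    also have "\<dots> = (\<Prod>j=1..n. \<integral>\<omega>. g (X 1 \<omega>) \<partial>M)"
      using g by (intro prod.cong transfer(2)) auto
    finally show "(\<integral>\<omega>. (\<Prod>j=1..n. g (X j \<omega>)) \<partial>M) = (\<integral>\<omega>. g (X 1 \<omega>) \<partial>M) ^ n"
      by simp
  qed
  have f1: "integrable M (\<lambda>\<omega>. f (X 1 \<omega>))"
    using f2 by (intro square_norm_integrable_imp_integrable) auto
  show int: "integrable M (\<lambda>\<omega>. \<Prod>j=1..n. f (X j \<omega>))"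
    by (rule prod(1)[OF f f1])
  have eq: "(cmod (\<Prod>j=1..n. f (X j \<omega>)))\<^sup>2 = (\<Prod>j=1..n. (cmod (f (X j \<omega>)))\<^sup>2)" for \<omega>
    by (simp only: prod_norm[symmetric] prod_power_distrib)
  have f_sq: "(\<lambda>x. (cmod (f x))\<^sup>2) \<in> borel_measurable borel"
    by measurable
  have "cvariance M (\<lambda>\<omega>. \<Prod>j=1..n. f (X j \<omega>)) = ennreal
      ((\<integral>\<omega>. (\<Prod>j=1..n. (cmod (f (X j \<omega>)))\<^sup>2) \<partial>M) - (cmod (\<integral>\<omega>. (\<Prod>j=1..n. f (X j \<omega>)) \<partial>M))\<^sup>2)"
    unfolding eq[symmetric]
    by (intro cvariance_eq(1) borel_measurable_integrable[OF int])
      (simp only: eq, intro prod(1) f2, simp)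
  then show "cvariance M (\<lambda>\<omega>. \<Prod>j=1..n. f (X j \<omega>)) =
      ennreal ((\<integral>\<omega>. (cmod (f (X 1 \<omega>)))\<^sup>2 \<partial>M) ^ n - ((cmod (\<integral>\<omega>. f (X 1 \<omega>) \<partial>M))\<^sup>2) ^ n)"
    by (simp only: prod(2)[OF f f1] prod(2)[OF f_sq f2] norm_power power_mult[symmetric] mult.commute[of n])
qed

text \<open>The limit theorem for a general measurable \<open>f\<close> in place of the logarithm,
  with an arbitrary shift \<open>d\<close>. All that is used of the logarithm is integrability, a
  bounded imaginary part and an exponential moment of the real part.\<close>

lemma cvariance_exp_mean_tendsto:
  fixes X :: "nat \<Rightarrow> 'a \<Rightarrow> real" and f :: "real \<Rightarrow> complex"
  assumes indep: "indep_vars (\<lambda>_. borel) X {1..}"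
    and ident: "\<And>i. i \<ge> 1 \<Longrightarrow> distr M borel (X i) = distr M borel (X 1)"
    and f[measurable]: "f \<in> borel_measurable borel"
    and L: "integrable M (\<lambda>\<omega>. f (X 1 \<omega>))" "\<And>x. \<bar>Im (f x)\<bar> \<le> K"
    and \<beta>: "\<beta> > 0" "integrable M (\<lambda>\<omega>. exp (\<beta> * Re (f (X 1 \<omega>))))"
  shows "(\<lambda>n. of_nat n * cvariance M (\<lambda>\<omega>. (\<Prod>j=1..n. exp (f (X j \<omega>) / of_nat n)) - d)) \<longlonglongrightarrow>
      ennreal (exp (2 * (\<integral>\<omega>. Re (f (X 1 \<omega>)) \<partial>M))) * cvariance M (\<lambda>\<omega>. f (X 1 \<omega>))"
proof -
  let ?E = "\<lambda>n \<omega>. exp (f (X 1 \<omega>) / of_nat n)"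
  let ?P = "\<lambda>n \<omega>. \<Prod>j=1..n. exp (f (X j \<omega>) / of_nat n)"
  let ?V = "\<lambda>n. cvariance M (\<lambda>\<omega>. of_nat n * (?E n \<omega> - 1))"
  define a where "a n = (\<integral>\<omega>. (cmod (?E n \<omega>))\<^sup>2 \<partial>M)" for n :: nat
  define b where "b n = (cmod (\<integral>\<omega>. ?E n \<omega> \<partial>M))\<^sup>2" for n :: nat
  define e where "e = exp (2 * (\<integral>\<omega>. Re (f (X 1 \<omega>)) \<partial>M))"
  have [measurable]: "X 1 \<in> borel_measurable M"
    using indep by (auto simp: indep_vars_def)
  have V: "?V \<longlonglongrightarrow> cvariance M (\<lambda>\<omega>. f (X 1 \<omega>))"
    by (rule cvariance_scaled_exp_tendsto[OF L(1) L(2) \<beta>])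
  have a: "(\<lambda>n. a n ^ (n - 1)) \<longlonglongrightarrow> e"
    unfolding e_def a_def
    by (intro power_tendsto_exp exp_square_norm_expectation(2)[OF L(1) \<beta>])
  have b: "(\<lambda>n. b n ^ (n - 1)) \<longlonglongrightarrow> e"
    unfolding e_def b_def
    by (intro power_tendsto_exp exp_expectation_square_norm[OF L(1) L(2) \<beta>])
  \<comment> \<open>Products of limits in \<open>ennreal\<close> fail only for zero times infinity;
    \<open>e\<close> is positive and finite, so the variance may be infinite.\<close>
  have lim: "(\<lambda>n. ennreal (c n ^ (n - 1)) * ?V n) \<longlonglongrightarrow> ennreal e * cvariance M (\<lambda>\<omega>. f (X 1 \<omega>))"
    if "(\<lambda>n. c n ^ (n - 1)) \<longlonglongrightarrow> e" for c
    using that by (intro tendsto_mult_ennreal V tendsto_ennrealI) (auto simp: e_def)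
  have bounds: "\<forall>\<^sub>F n in sequentially.
      ennreal (b n ^ (n - 1)) * ?V n \<le> of_nat n * cvariance M (\<lambda>\<omega>. ?P n \<omega> - d) \<and>
      of_nat n * cvariance M (\<lambda>\<omega>. ?P n \<omega> - d) \<le> ennreal (a n ^ (n - 1)) * ?V n"
    using exp_square_norm_expectation(1)[OF L(1) \<beta>]
  proof eventually_elim
    case (elim n)
    have E_meas: "?E n \<in> borel_measurable M" and f_meas: "(\<lambda>x. exp (f x / of_nat n)) \<in> borel_measurable borel"
      by measurable
    have E: "integrable M (?E n)"
      using E_meas elim by (rule square_norm_integrable_imp_integrable)
    note E_var = cvariance_eq[OF E_meas elim, folded a_def b_def]
    have b0: "0 \<le> b n"
      by (simp add: b_def)
    note ba = E_var(2)
    have V: "?V n = ennreal ((real n)\<^sup>2 * (a n - b n))"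
      unfolding cvariance_affine[OF E] E_var(1) using ba by (simp add: ennreal_mult)
    note iid = cvariance_iid_prod[OF indep ident f_meas elim, of n, folded a_def b_def]
    have "cvariance M (\<lambda>\<omega>. ?P n \<omega> - d) = cvariance M (?P n)"
      using cvariance_affine[of "?P n" 1 d] iid(1) by simp
    also have "\<dots> = ennreal (a n ^ n - b n ^ n)"
      by (rule iid(2))
    finally have P: "of_nat n * cvariance M (\<lambda>\<omega>. ?P n \<omega> - d) = ennreal (real n * (a n ^ n - b n ^ n))"
      using power_mono[OF ba b0] by (simp add: ennreal_mult ennreal_of_nat_eq_real_of_nat)
    \<comment> \<open>One factor \<open>n\<close> of the square is kept outside to match
      \<open>P\<close>; what remains inside is exactly a bound from
      \<open>power_diff_bounds\<close>, with \<open>c\<close> equal to \<open>b n\<close> or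
      \<open>a n\<close>.\<close>
    have mult: "ennreal (c ^ (n - 1)) * ?V n = ennreal (real n * (real n * (a n - b n) * c ^ (n - 1)))"
      if "0 \<le> c" for c
      using that ba unfolding V by (subst ennreal_mult[symmetric]) (auto simp: power2_eq_square mult_ac)
    show ?case
      unfolding P mult[OF b0] mult[OF order.trans[OF b0 ba]]
      using power_diff_bounds[OF b0 ba, of n]
      by (intro conjI ennreal_leI mult_left_mono) auto
  qed
  show ?thesis
    unfolding e_def[symmetric]
    by (rule tendsto_sandwich[OF _ _ lim[OF b] lim[OF a]]) (use bounds in \<open>auto elim: eventually_mono\<close>)
qed

end

section \<open>Application to the logarithm\<close>

text \<open>For real \<alpha> the law of \<open>X 1\<close> may put so much mass near
  \<open>- \<alpha>\<close> that the logarithm has no finite mean; the last hypothesis makes the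
  expectation in the limit genuine. For \<open>Im \<alpha> > 0\<close> this integrability is derived
  from the moment condition. The limit is taken in \<open>ennreal\<close> and may be
  infinite.\<close>

theorem theorem2p1:
  fixes M :: "'a measure" and X :: "nat \<Rightarrow> 'a \<Rightarrow> real" and \<alpha> :: complex
  assumes "prob_space M"
    and "Im \<alpha> \<ge> 0"
    and "prob_space.indep_vars M (\<lambda>_. borel) X {1..}"
    and "\<And>i. i \<ge> 1 \<Longrightarrow> distr M borel (X i) = distr M borel (X 1)"
    and "\<And>i x. i \<ge> 1 \<Longrightarrow> measure M {\<omega> \<in> space M. X i \<omega> = x} = 0"
    and "\<exists>\<beta>>0. integrable M (\<lambda>\<omega>. \<bar>X 1 \<omega>\<bar> powr \<beta>)"
    and "Im \<alpha> = 0 \<Longrightarrow> integrable M (\<lambda>\<omega>. ln (cmod (of_real (X 1 \<omega>) + \<alpha>)))"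
  shows "(\<lambda>n. of_nat n * cvariance M (geom_mean \<alpha> X n)) \<longlonglongrightarrow>
           ennreal (exp (2 * (\<integral>\<omega>. ln (cmod (of_real (X 1 \<omega>) + \<alpha>)) \<partial>M)))
             * cvariance M (\<lambda>\<omega>. log_cut (of_real (X 1 \<omega>) + \<alpha>))"
proof -
  interpret prob_space M by fact
  define f where "f = (\<lambda>x::real. log_cut (of_real x + \<alpha>))"
  have f[measurable]: "f \<in> borel_measurable borel"
    unfolding f_def by (rule borel_measurable_log_cut_shift[OF assms(2)])
  have X[measurable]: "X 1 \<in> borel_measurable M"
    using assms(3) by (auto simp: indep_vars_def)
  obtain \<beta> where \<beta>: "\<beta> > 0" "integrable M (\<lambda>\<omega>. \<bar>X 1 \<omega>\<bar> powr \<beta>)"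
    using assms(6) by blast
  let ?U = "\<lambda>\<omega>. Re (f (X 1 \<omega>))"
  have U: "?U \<omega> = ln (cmod (of_real (X 1 \<omega>) + \<alpha>))" for \<omega>
    by (simp add: f_def)
  have Im: "\<bar>Im (f x)\<bar> \<le> 3 * pi / 2" for x
    unfolding f_def by (rule abs_Im_log_cut_le)
  have exp_int: "integrable M (\<lambda>\<omega>. exp (\<beta> * ?U \<omega>))"
  proof (rule Bochner_Integration.integrable_bound)
    \<comment> \<open>The summand \<open>1\<close> covers the points where
      \<open>X 1 + \<alpha>\<close> vanishes, since there \<open>ln 0 = 0\<close> makes the
      exponential \<open>1\<close>. Elsewhere the exponential is
      \<open>cmod (X 1 + \<alpha>) powr \<beta>\<close>, and the modulus is at most twice the larger
      of the two moduli.\<close>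
    show "integrable M (\<lambda>\<omega>. 1 + 2 powr \<beta> * (\<bar>X 1 \<omega>\<bar> powr \<beta> + cmod \<alpha> powr \<beta>))"
      using \<beta> by (intro Bochner_Integration.integrable_add integrable_mult_right) auto
    have "exp (\<beta> * ?U \<omega>) \<le> 1 + 2 powr \<beta> * (\<bar>X 1 \<omega>\<bar> powr \<beta> + cmod \<alpha> powr \<beta>)" for \<omega>
    proof (cases "of_real (X 1 \<omega>) + \<alpha> = 0")
      case False
      let ?m = "max \<bar>X 1 \<omega>\<bar> (cmod \<alpha>)"
      have "exp (\<beta> * ?U \<omega>) = cmod (of_real (X 1 \<omega>) + \<alpha>) powr \<beta>"
        unfolding U using False by (simp add: powr_def)
      also have "\<dots> \<le> (2 * ?m) powr \<beta>"
      proof (rule powr_mono2)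
        show "cmod (of_real (X 1 \<omega>) + \<alpha>) \<le> 2 * ?m"
          using norm_triangle_ineq[of "of_real (X 1 \<omega>)" \<alpha>] by simp
      qed (use \<beta> in auto)
      also have "\<dots> = 2 powr \<beta> * ?m powr \<beta>"
        by (simp add: powr_mult)
      also have "\<dots> \<le> 2 powr \<beta> * (\<bar>X 1 \<omega>\<bar> powr \<beta> + cmod \<alpha> powr \<beta>)"
        by (intro mult_left_mono) (auto simp: max_def)
      finally show ?thesis
        by simp
    next
      case True
      then have "?U \<omega> = 0"
        unfolding U by simp
      then show ?thesis
        by simp
    qed
    then show "AE \<omega> in M. norm (exp (\<beta> * ?U \<omega>))
        \<le> norm (1 + 2 powr \<beta> * (\<bar>X 1 \<omega>\<bar> powr \<beta> + cmod \<alpha> powr \<beta>))"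
      by (intro AE_I2) (simp add: order.trans[OF _ abs_ge_self])
  qed measurable
  have U_int: "integrable M ?U"
  proof (cases "Im \<alpha> = 0")
    case True
    then show ?thesis
      unfolding U by (rule assms(7))
  next
    case False
    then have pos: "0 < Im \<alpha>"
      using assms(2) by simp
    show ?thesis
    proof (rule Bochner_Integration.integrable_bound)
      \<comment> \<open>The modulus of \<open>X 1 + \<alpha>\<close> is at least
        \<open>Im \<alpha>\<close>, which bounds \<open>?U\<close> below by a constant; above,
        \<open>t <= exp t\<close> with \<open>t = \<beta> * ?U\<close> bounds it by the exponential
        moment.\<close>
      show "integrable M (\<lambda>\<omega>. \<bar>ln (Im \<alpha>)\<bar> + exp (\<beta> * ?U \<omega>) / \<beta>)"
        using exp_int by (intro Bochner_Integration.integrable_add integrable_divide) auto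
      have "\<bar>?U \<omega>\<bar> \<le> \<bar>ln (Im \<alpha>)\<bar> + exp (\<beta> * ?U \<omega>) / \<beta>" for \<omega>
      proof -
        have "Im \<alpha> \<le> cmod (of_real (X 1 \<omega>) + \<alpha>)"
          using abs_Im_le_cmod[of "of_real (X 1 \<omega>) + \<alpha>"] by simp
        then have "ln (Im \<alpha>) \<le> ?U \<omega>"
          using pos unfolding U by (intro ln_mono) auto
        moreover have "\<beta> * ?U \<omega> \<le> exp (\<beta> * ?U \<omega>)"
          using exp_ge_add_one_self[of "\<beta> * ?U \<omega>"] by linarith
        then have "?U \<omega> \<le> exp (\<beta> * ?U \<omega>) / \<beta>"
          using \<beta>(1) by (simp add: pos_le_divide_eq mult.commute)
        moreover have "0 \<le> exp (\<beta> * ?U \<omega>) / \<beta>"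
          using \<beta>(1) by simp
        ultimately show ?thesis
          by linarith
      qed
      then show "AE \<omega> in M. norm (?U \<omega>) \<le> norm (\<bar>ln (Im \<alpha>)\<bar> + exp (\<beta> * ?U \<omega>) / \<beta>)"
        by (intro AE_I2) (simp add: order.trans[OF _ abs_ge_self])
    qed measurable
  qed
  have L_int: "integrable M (\<lambda>\<omega>. f (X 1 \<omega>))"
  proof (rule Bochner_Integration.integrable_bound)
    show "integrable M (\<lambda>\<omega>. \<bar>?U \<omega>\<bar> + 3 * pi / 2)"
      using U_int by auto
    show "AE \<omega> in M. norm (f (X 1 \<omega>)) \<le> norm (\<bar>?U \<omega>\<bar> + 3 * pi / 2)"
      using cmod_le Im by (intro AE_I2) (smt (verit) real_norm_def)
  qed measurable
  have "geom_mean \<alpha> X n = (\<lambda>\<omega>. (\<Prod>j=1..n. exp (f (X j \<omega>) / of_nat n)) - \<alpha>)" for n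
    by (simp add: fun_eq_iff geom_mean_def pow_cut_def f_def)
  then show ?thesis
    using cvariance_exp_mean_tendsto[OF assms(3,4) f L_int Im \<beta>(1) exp_int, of \<alpha>]
    unfolding U by (simp add: f_def)
qed

end
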